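(* Let $X\subseteq\mathbb{R}^n$, $Y\subseteq\mathbb{R}^m$ be convex, closed, nonempty, with $Y$ compact of diameter $D_Y$. Let $f,g_1,\dots,g_p$ be proper, lower semicontinuous, convex, differentiable on $Y\times X$, with $Y\times X\subset\mathrm{dom}(g_i)$ for all $i$; let $g=(g_1,\dots,g_p)$, let $A,B$ be matrices and $b$ a vector of compatible sizes, and $$\mathcal{Q}(x)=\min_y\{f(y,x): g(y,x)\le0,\ Ay+Bx=b,\ y\in Y\}.$$ Take $\bar x\in X$ and assume there exists $y_{\bar x}\in\mathrm{ri}(Y)$ with $Ay_{\bar x}+B\bar x=b$ and $g(y_{\bar x},\bar x)<0$, and that $f(\cdot,\bar x)$ is finite on $\{y\in Y: Ay+B\bar x=b,\ g(y,\bar x)\le0\}$. Assume that $\nabla_yf(\cdot,\bar x)$ is $L_0$-co-coercive and $\nabla_yg_i(\cdot,\bar x)$ is $L_i$-co-coercive on $Y$, with $L_i>0$, $i=0,\dots,p$. Let $\varepsilon\ge0$, let $\hat y$ be an $\varepsilon$-optimal feasible solution of the problem defining $\mathcal{Q}(\bar x)$, and let $\mathcal{C}_1,\mathcal{C}_2$ be the two affine functions (inexact cuts for $\mathcal{Q}$ at $\bar x$) built from $\hat y$ and, respectively, an $\varepsilon$-optimal solution $\tilde\lambda$ of the copy-variable dual and an $\varepsilon$-optimal feasible solution $(\hat\lambda,\hat\mu)$ of the Lagrangian dual, as follows: $$\mathcal{C}_1(x)=f(\hat y,\bar x)-2\varepsilon+\langle\tilde\lambda,x-\bar x\rangle,$$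 $$\mathcal{C}_2(x)=L_{\bar x}(\hat y,\hat\lambda,\hat\mu)-\max_{y\in Y}\langle\nabla_yL_{\bar x}(\hat y,\hat\lambda,\hat\mu),\hat y-y\rangle+\langle\nabla_xL_{\bar x}(\hat y,\hat\lambda,\hat\mu),x-\bar x\rangle .$$ Let $\mathcal{L}_{\bar x}$ be any lower bound on $\mathcal{Q}(\bar x)$ and set $$\mathcal{U}_{\bar x}=\frac{f(y_{\bar x},\bar x)-\mathcal{L}_{\bar x}+\varepsilon}{\min(-g_i(y_{\bar x},\bar x),\ i=1,\dots,p)},\qquad L=L_0+\mathcal{U}_{\bar x}\max_{i=1,\dots,p}L_i .$$ Then $$-2\varepsilon\le\mathcal{C}_1(\bar x)-\mathcal{C}_2(\bar x)\le2\varepsilon+2D_Y\sqrt{L\varepsilon}.$$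
   Context: Lagrangian and Lagrangian dual: $L_x(y,\lambda,\mu)=f(y,x)+\langle\lambda,Bx+Ay-b\rangle+\langle\mu,g(y,x)\rangle$; the Lagrangian dual at $x$ is $\max_{\mu\ge0,\lambda}\ \min_{y\in Y}L_x(y,\lambda,\mu)$. Copy-variable dual at $x$: $\max_{\lambda\in\mathbb{R}^n}\ \min\{f(y,z)+\langle\lambda,x-z\rangle:(y,z)\in S\}$ with $S=\{(y,z)\in\mathbb{R}^m\times\mathbb{R}^n: g(y,z)\le0,\ Ay+Bz=b,\ y\in Y\}$. The functions $f,g_i$ take values in $\,]-\infty,+\infty]$ and are regarded as extended-valued functions on $\mathbb{R}^m\times\mathbb{R}^n$. Both duals are taken at $x=\bar x$. An $\varepsilon$-optimal feasible solution of a minimization (resp. maximization) problem is a feasible point whose objective value is at most the optimal value plus $\varepsilon$ (resp. at least the optimal value minus $\varepsilon$). A map $F:\mathrm{Dom}(F)\subseteq\mathbb{R}^m\to\mathbb{R}^m$ is $L$-co-coercive on $\Omega\subseteq\mathrm{Dom}(F)$ if $L\langle y-x,F(y)-F(x)\rangle\ge\|F(y)-F(x)\|^2$ for all $x,y\in\Omega$ (Euclidean inner product and norm). An affine function $\mathcal{C}$ is an $\varepsilon'$-inexact cut for $\mathcal{Q}$ at $\bar x\in X$ if $\mathcal{Q}\ge\mathcal{C}$ on $X$ and $\mathcal{Q}(\bar x)-\mathcal{C}(\bar x)\le\varepsilon'$, where $\mathcal{Q}:X\to\mathbb{R}$ is convex and $X\subset\mathrm{ri}(\mathrm{dom}(\mathcal{Q}))$;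 $\mathrm{ri}$ is relative interior. *)

theory Defs
  imports "HOL-Analysis.Analysis"
begin

subsection \<open>Extended-valued functions\<close>

definition ext_dom :: "('a \<Rightarrow> ereal) \<Rightarrow> 'a set" where
  "ext_dom F = {z. F z < \<infinity>}"

definition ext_proper :: "('a \<Rightarrow> ereal) \<Rightarrow> bool" where
  "ext_proper F \<longleftrightarrow> (\<forall>z. F z \<noteq> -\<infinity>) \<and> ext_dom F \<noteq> {}"

text \<open>The library's \<open>epigraph\<close> and \<open>convex_on\<close> only cover real-valued functions.\<close>

definition ext_convex :: "('a::real_vector \<Rightarrow> ereal) \<Rightarrow> bool" where
  "ext_convex F \<longleftrightarrow> convex {(z, r::real). F z \<le> ereal r}"

definition ext_lsc :: "('a::topological_space \<Rightarrow> ereal) \<Rightarrow> bool" where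
  "ext_lsc F \<longleftrightarrow> (\<forall>z. F z \<le> Liminf (at z) F)"

text \<open>Differentiability of an extended-valued function at a point entails, as usual in convex
  analysis, that the function is finite in a neighbourhood of that point.\<close>

definition ext_differentiable_on :: "('a::real_normed_vector \<Rightarrow> ereal) \<Rightarrow> 'a set \<Rightarrow> bool" where
  "ext_differentiable_on F S \<longleftrightarrow>
     (\<forall>z\<in>S. (\<forall>\<^sub>F w in nhds z. \<bar>F w\<bar> \<noteq> \<infinity>) \<and>
            (\<lambda>w. real_of_ereal (F w)) differentiable (at z))"

text \<open>Only meaningful at points where \<open>h\<close> is differentiable, where the gradient is unique.\<close>

definition grad :: "('a::real_inner \<Rightarrow> real) \<Rightarrow> 'a \<Rightarrow> 'a" where
  "grad h z = (THE D. GDERIV h z :> D)"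

definition cocoercive_on :: "real \<Rightarrow> 'a::real_inner set \<Rightarrow> ('a \<Rightarrow> 'a) \<Rightarrow> bool" where
  "cocoercive_on L \<Omega> F \<longleftrightarrow>
     (\<forall>x\<in>\<Omega>. \<forall>y\<in>\<Omega>. L * ((y - x) \<bullet> (F y - F x)) \<ge> (norm (F y - F x))\<^sup>2)"

subsection \<open>Approximate solutions\<close>

definition eps_opt_min :: "real \<Rightarrow> ('a \<Rightarrow> ereal) \<Rightarrow> 'a set \<Rightarrow> 'a \<Rightarrow> bool" where
  "eps_opt_min \<epsilon> F S z \<longleftrightarrow> z \<in> S \<and> F z \<le> (INF w\<in>S. F w) + ereal \<epsilon>"

definition eps_opt_max :: "real \<Rightarrow> ('a \<Rightarrow> ereal) \<Rightarrow> 'a set \<Rightarrow> 'a \<Rightarrow> bool" where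
  "eps_opt_max \<epsilon> F S z \<longleftrightarrow> z \<in> S \<and> F z \<ge> (SUP w\<in>S. F w) - ereal \<epsilon>"

subsection \<open>The parametric problem and its duals\<close>

text \<open>Inequality constraints are indexed by the finite type \<open>'p\<close>, so that there is at least one;
  functions of \<open>(y, x)\<close> are functions on the product space.\<close>

definition feasible_set ::
  "(real^'m) set \<Rightarrow> ('p::finite \<Rightarrow> (real^'m) \<times> (real^'n) \<Rightarrow> ereal) \<Rightarrow>
   real^'m^'q \<Rightarrow> real^'n^'q \<Rightarrow> real^'q \<Rightarrow> real^'n \<Rightarrow> (real^'m) set" where
  "feasible_set Y g A B b x =
     {y. (\<forall>i. g i (y, x) \<le> 0) \<and> A *v y + B *v x = b \<and> y \<in> Y}"

definition value_function ::
  "(real^'m) set \<Rightarrow> ((real^'m) \<times> (real^'n) \<Rightarrow> ereal) \<Rightarrow>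
   ('p::finite \<Rightarrow> (real^'m) \<times> (real^'n) \<Rightarrow> ereal) \<Rightarrow>
   real^'m^'q \<Rightarrow> real^'n^'q \<Rightarrow> real^'q \<Rightarrow> real^'n \<Rightarrow> ereal" where
  "value_function Y f g A B b x = (INF y\<in>feasible_set Y g A B b x. f (y, x))"

definition copy_set ::
  "(real^'m) set \<Rightarrow> ('p::finite \<Rightarrow> (real^'m) \<times> (real^'n) \<Rightarrow> ereal) \<Rightarrow>
   real^'m^'q \<Rightarrow> real^'n^'q \<Rightarrow> real^'q \<Rightarrow> ((real^'m) \<times> (real^'n)) set" where
  "copy_set Y g A B b =
     {(y, z). (\<forall>i. g i (y, z) \<le> 0) \<and> A *v y + B *v z = b \<and> y \<in> Y}"

definition copy_dual_fun ::
  "(real^'m) set \<Rightarrow> ((real^'m) \<times> (real^'n) \<Rightarrow> ereal) \<Rightarrow>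
   ('p::finite \<Rightarrow> (real^'m) \<times> (real^'n) \<Rightarrow> ereal) \<Rightarrow>
   real^'m^'q \<Rightarrow> real^'n^'q \<Rightarrow> real^'q \<Rightarrow> real^'n \<Rightarrow> real^'n \<Rightarrow> ereal" where
  "copy_dual_fun Y f g A B b x lam =
     (INF (y, z)\<in>copy_set Y g A B b. f (y, z) + ereal (lam \<bullet> (x - z)))"

definition lagrangian ::
  "((real^'m) \<times> (real^'n) \<Rightarrow> ereal) \<Rightarrow>
   ('p::finite \<Rightarrow> (real^'m) \<times> (real^'n) \<Rightarrow> ereal) \<Rightarrow>
   real^'m^'q \<Rightarrow> real^'n^'q \<Rightarrow> real^'q \<Rightarrow>
   real^'n \<Rightarrow> real^'m \<Rightarrow> real^'q \<Rightarrow> real^'p \<Rightarrow> ereal" where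
  "lagrangian f g A B b x y lam mu =
     f (y, x) + ereal (lam \<bullet> (B *v x + A *v y - b)) + (\<Sum>i\<in>UNIV. ereal (mu $ i) * g i (y, x))"

definition lagrangian_dual_fun ::
  "(real^'m) set \<Rightarrow> ((real^'m) \<times> (real^'n) \<Rightarrow> ereal) \<Rightarrow>
   ('p::finite \<Rightarrow> (real^'m) \<times> (real^'n) \<Rightarrow> ereal) \<Rightarrow>
   real^'m^'q \<Rightarrow> real^'n^'q \<Rightarrow> real^'q \<Rightarrow> real^'n \<Rightarrow> (real^'q) \<times> (real^'p) \<Rightarrow> ereal" where
  "lagrangian_dual_fun Y f g A B b x = (\<lambda>(lam, mu). INF y\<in>Y. lagrangian f g A B b x y lam mu)"

definition lagrangian_dual_feasible :: "((real^'q) \<times> (real^'p)) set" where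
  "lagrangian_dual_feasible = {(lam, mu). \<forall>i. 0 \<le> mu $ i}"

subsection \<open>The two cuts\<close>

definition cut1 ::
  "((real^'m) \<times> (real^'n) \<Rightarrow> ereal) \<Rightarrow> real \<Rightarrow> real^'n \<Rightarrow> real^'m \<Rightarrow> real^'n \<Rightarrow> real^'n \<Rightarrow> real" where
  "cut1 f \<epsilon> xb yh lam x = real_of_ereal (f (yh, xb)) - 2 * \<epsilon> + lam \<bullet> (x - xb)"

text \<open>For nonempty compact \<open>Y\<close> the supremum below is attained, the function being affine in \<open>y\<close>.
  The conversion to \<open>real\<close> is harmless when \<open>f\<close> and all \<open>g i\<close> are finite near \<open>(yh, xb)\<close>.\<close>

definition cut2 ::
  "(real^'m) set \<Rightarrow> ((real^'m) \<times> (real^'n) \<Rightarrow> ereal) \<Rightarrow>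
   ('p::finite \<Rightarrow> (real^'m) \<times> (real^'n) \<Rightarrow> ereal) \<Rightarrow>
   real^'m^'q \<Rightarrow> real^'n^'q \<Rightarrow> real^'q \<Rightarrow>
   real^'n \<Rightarrow> real^'m \<Rightarrow> real^'q \<Rightarrow> real^'p \<Rightarrow> real^'n \<Rightarrow> real" where
  "cut2 Y f g A B b xb yh lam mu x =
     real_of_ereal (lagrangian f g A B b xb yh lam mu)
     - (SUP y\<in>Y. grad (\<lambda>y'. real_of_ereal (lagrangian f g A B b xb y' lam mu)) yh \<bullet> (yh - y))
     + grad (\<lambda>x'. real_of_ereal (lagrangian f g A B b x' yh lam mu)) xb \<bullet> (x - xb)"

end

theory Submission
  imports Defs
begin

text \<open>
  At \<open>xb\<close> the linear parts of both cuts vanish, and the feasibility of \<open>yh\<close> makes the equality term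
  of the Lagrangian vanish as well. Hence
  \<open>C1 xb - C2 xb = - 2 * \<epsilon> + slack + gap\<close>, where
  \<open>slack = - (\<Sum>i. muh $ i * g i (yh, xb))\<close> is the complementarity error and
  \<open>gap\<close> is the maximum over \<open>y \<in> Y\<close> of \<open>grad Lag yh \<bullet> (yh - y)\<close>, the Frank-Wolfe gap of the
  Lagrangian \<open>Lag\<close> at \<open>yh\<close>. Both are nonnegative, which is the lower bound.

  For the upper bound, the Slater point yields strong duality
  (\<open>lagrangian_strong_duality\<close>), so the two \<open>\<epsilon>\<close>-optimality assumptions place the dual value at
  \<open>(lamh, muh)\<close> within \<open>2 * \<epsilon>\<close> of \<open>f (yh, xb)\<close>. This budget is shared: \<open>yh\<close> minimizes \<open>Lag\<close>
  over \<open>Y\<close> up to \<open>\<delta> = 2 * \<epsilon> - slack\<close>. Evaluating \<open>Lag\<close> at the Slater point bounds the sum of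
  the multipliers by \<open>U\<close>, so \<open>Lag\<close> obeys a quadratic upper bound along \<open>Y\<close> with constant
  \<open>M \<le> L\<close> (\<open>descent_lemma\<close>). Moving from \<open>yh\<close> towards \<open>y\<close> by a fraction \<open>t \<in> [0, 1]\<close> of the way cannot
  decrease \<open>Lag\<close> by more than \<open>\<delta>\<close>; the best \<open>t\<close> gives \<open>gap \<le> D * sqrt (2 * M * \<delta>)\<close> with
  \<open>D\<close> the diameter of \<open>Y\<close>, or
  \<open>gap \<le> 2 * \<delta>\<close> when the best \<open>t\<close> would exceed 1
  (\<open>frank_wolfe_gap_bound\<close>). In the first case \<open>slack \<le> 2 * \<epsilon>\<close> and \<open>\<delta> \<le> 2 * \<epsilon>\<close> give
  the total \<open>2 * D * sqrt (L * \<epsilon>)\<close>; in the second the total is at most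
  \<open>- 2 * \<epsilon> + slack + 2 * \<delta> = \<delta> \<le> 2 * \<epsilon>\<close>.
\<close>

section \<open>Gradients\<close>

lemma gderiv_grad:
  fixes h :: "'a::euclidean_space \<Rightarrow> real"
  assumes "h differentiable (at z)"
  shows "GDERIV h z :> grad h z"
proof -
  obtain D where D: "(h has_derivative D) (at z)"
    using assms by (auto simp: differentiable_def)
  then have lin: "linear D"
    by (simp add: has_derivative_linear)
  have "D v = v \<bullet> adjoint D 1" for v
    using adjoint_works[OF lin, of v 1] by simp
  then have "D = (\<lambda>v. v \<bullet> adjoint D 1)"
    by blast
  then have ex: "GDERIV h z :> adjoint D 1"
    using D by (simp add: gderiv_def)
  have "D' = adjoint D 1" if "GDERIV h z :> D'" for D'
  proof -
    have "(\<lambda>v. v \<bullet> D') = (\<lambda>v. v \<bullet> adjoint D 1)"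
      using that ex unfolding gderiv_def by (rule has_derivative_unique)
    then have "\<forall>v. v \<bullet> D' = v \<bullet> adjoint D 1"
      by metis
    then show ?thesis
      by (simp add: vector_eq_ldot)
  qed
  with ex show ?thesis
    unfolding grad_def by (metis theI)
qed

lemma grad_eqI:
  fixes h :: "'a::euclidean_space \<Rightarrow> real"
  assumes "GDERIV h z :> D"
  shows "grad h z = D"
proof -
  have "h differentiable (at z)"
    using assms by (auto simp: gderiv_def differentiable_def)
  from gderiv_grad[OF this] assms have "(\<lambda>v. v \<bullet> grad h z) = (\<lambda>v. v \<bullet> D)"
    unfolding gderiv_def by (rule has_derivative_unique)
  then have "\<forall>v. v \<bullet> grad h z = v \<bullet> D"
    by metis
  then show ?thesis
    by (simp add: vector_eq_ldot)
qed

section \<open>Smoothness and the Frank-Wolfe gap\<close>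

lemma cocoercive_on_imp_lipschitz:
  assumes "cocoercive_on K S F" "0 \<le> K" "x \<in> S" "y \<in> S"
  shows "norm (F y - F x) \<le> K * norm (y - x)"
proof (cases "F y = F x")
  case True
  then show ?thesis using assms by simp
next
  case False
  have "(norm (F y - F x))\<^sup>2 \<le> K * ((y - x) \<bullet> (F y - F x))"
    using assms by (simp add: cocoercive_on_def)
  also have "\<dots> \<le> K * (norm (y - x) * norm (F y - F x))"
    using \<open>0 \<le> K\<close> by (intro mult_left_mono norm_cauchy_schwarz)
  finally show ?thesis
    using False by (simp add: power2_eq_square)
qed

text \<open>The derivative of \<open>h\<close> along the segment from \<open>x\<close> to \<open>z\<close> grows at most linearly, so subtracting
  the claimed quadratic leaves a nonincreasing function of the segment parameter. Only points of the
  segment are visited, so a bound on gradient differences within \<open>S\<close> suffices; no step leaves \<open>S\<close>.\<close>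
lemma descent_lemma:
  fixes h :: "'a::real_inner \<Rightarrow> real"
  assumes "convex S" "x \<in> S" "z \<in> S"
    and D: "\<And>y. y \<in> S \<Longrightarrow> GDERIV h y :> h' y"
    and lip: "\<And>y. y \<in> S \<Longrightarrow> norm (h' y - h' x) \<le> K * norm (y - x)"
  shows "h z \<le> h x + h' x \<bullet> (z - x) + K / 2 * (norm (z - x))\<^sup>2"
proof -
  define d where "d = z - x"
  define \<psi> where "\<psi> s = h (x + s *\<^sub>R d) - s * (h' x \<bullet> d) - K / 2 * s\<^sup>2 * (norm d)\<^sup>2" for s
  have mem: "x + s *\<^sub>R d \<in> S" if "0 \<le> s" "s \<le> 1" for s
    using convexD_alt[OF assms(1,2,3) that] by (simp add: d_def algebra_simps)
  have "\<psi> 1 \<le> \<psi> 0"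
  proof (rule DERIV_nonpos_imp_nonincreasing, simp)
    fix s :: real
    assume s: "0 \<le> s" "s \<le> 1"
    let ?e = "d \<bullet> h' (x + s *\<^sub>R d) - h' x \<bullet> d - K * s * (norm d)\<^sup>2"
    have "(h has_derivative (\<lambda>v. v \<bullet> h' (x + s *\<^sub>R d))) (at (x + s *\<^sub>R d))"
      using D[OF mem[OF s]] by (simp add: gderiv_def)
    moreover have "((\<lambda>s. x + s *\<^sub>R d) has_derivative (\<lambda>t. t *\<^sub>R d)) (at s)"
      by (auto intro!: derivative_eq_intros)
    ultimately have "((\<lambda>s. h (x + s *\<^sub>R d)) has_derivative (\<lambda>t. (t *\<^sub>R d) \<bullet> h' (x + s *\<^sub>R d))) (at s)"
      by (rule has_derivative_compose[rotated])
    then have "DERIV (\<lambda>s. h (x + s *\<^sub>R d)) s :> d \<bullet> h' (x + s *\<^sub>R d)"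
      by (simp add: has_field_derivative_def mult_commute_abs)
    then have "DERIV \<psi> s :> ?e"
      unfolding \<psi>_def by (auto intro!: derivative_eq_intros)
    moreover have "?e \<le> 0"
    proof -
      have "d \<bullet> (h' (x + s *\<^sub>R d) - h' x) \<le> norm d * norm (h' (x + s *\<^sub>R d) - h' x)"
        by (rule norm_cauchy_schwarz)
      also have "\<dots> \<le> norm d * (K * norm ((x + s *\<^sub>R d) - x))"
        by (intro mult_left_mono lip mem s) simp
      also have "\<dots> = K * s * (norm d)\<^sup>2"
        using s by (simp add: power2_eq_square)
      finally show ?thesis
        by (simp add: inner_diff_right inner_commute)
    qed
    ultimately show "\<exists>y. DERIV \<psi> s :> y \<and> y \<le> 0"
      by blast
  qed
  then show ?thesis
    by (simp add: \<psi>_def d_def)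
qed

text \<open>Here \<open>l\<close> is the decrease promised by the linearization over a displacement of length at most \<open>D\<close>,
  and \<open>\<delta>\<close> a bound on the actual decrease. The quadratic in \<open>t\<close> is maximal at
  \<open>t = l / (M * D\<^sup>2)\<close>; if that exceeds 1, the full step \<open>t = 1\<close> still realizes half of \<open>l\<close>.\<close>
lemma frank_wolfe_gap_bound:
  fixes l M D \<delta> :: real
  assumes "0 \<le> D" "0 < M" "0 \<le> \<delta>"
    and decr: "\<And>t. 0 \<le> t \<Longrightarrow> t \<le> 1 \<Longrightarrow> t * l - M / 2 * t\<^sup>2 * D\<^sup>2 \<le> \<delta>"
  shows "l \<le> D * sqrt (2 * M * \<delta>) \<or> l \<le> 2 * \<delta>"
proof (cases "l \<le> 0")
  case True
  then show ?thesis using \<open>0 \<le> \<delta>\<close> by auto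
next
  case False
  show ?thesis
  proof (cases "l \<le> M * D\<^sup>2")
    case True
    then have pos: "0 < M * D\<^sup>2"
      using False by simp
    define t where "t = l / (M * D\<^sup>2)"
    have t: "0 \<le> t" "t \<le> 1"
      using True False pos by (auto simp: t_def)
    have tl: "t * (M * D\<^sup>2) = l"
      using pos by (auto simp: t_def)
    have "t * l - M / 2 * t\<^sup>2 * D\<^sup>2 = t * l - (t * (M * D\<^sup>2)) * t / 2"
      by (simp add: power2_eq_square)
    also have "\<dots> = t * l / 2"
      by (simp add: tl)
    finally have "t * l / 2 \<le> \<delta>"
      using decr[OF t] by (simp only:)
    then have "t * l / 2 * (2 * (M * D\<^sup>2)) \<le> \<delta> * (2 * (M * D\<^sup>2))"
      using pos by (intro mult_right_mono) auto
    moreover have "t * l / 2 * (2 * (M * D\<^sup>2)) = (t * (M * D\<^sup>2)) * l"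
      by (simp add: algebra_simps)
    ultimately have "l * l \<le> \<delta> * (2 * (M * D\<^sup>2))"
      by (simp only: tl)
    then have "l\<^sup>2 \<le> D\<^sup>2 * (2 * M * \<delta>)"
      by (simp add: power2_eq_square algebra_simps)
    then have "l \<le> sqrt (D\<^sup>2 * (2 * M * \<delta>))"
      by (rule real_le_rsqrt)
    also have "\<dots> = D * sqrt (2 * M * \<delta>)"
      using \<open>0 \<le> D\<close> by (simp add: real_sqrt_mult)
    finally show ?thesis by blast
  next
    case big: False
    then show ?thesis
      using decr[of 1] by simp
  qed
qed

section \<open>Lagrangian strong duality under a Slater condition\<close>

text \<open>From any \<open>y \<in> S\<close> the segment to \<open>y0\<close> can be prolonged within \<open>S\<close> beyond \<open>y0\<close>, and \<open>T\<close> would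
  drop below its minimum there if \<open>T y > T y0\<close>.\<close>
lemma linear_min_at_rel_interior:
  fixes S :: "'a::euclidean_space set"
  assumes "convex S" "y0 \<in> rel_interior S" "linear T"
    and min: "\<And>y. y \<in> S \<Longrightarrow> (T y0 :: real) \<le> T y"
    and "y \<in> S"
  shows "T y = T y0"
proof -
  obtain e where e: "e > 1" "(1 - e) *\<^sub>R y + e *\<^sub>R y0 \<in> S"
    using assms convex_rel_interior_iff[of S y0] by blast
  have "T y0 \<le> (1 - e) * T y + e * T y0"
    using min[OF e(2)] \<open>linear T\<close> by (simp add: linear_add linear_scale)
  then have "(e - 1) * T y \<le> (e - 1) * T y0"
    by (simp add: algebra_simps)
  then have "T y \<le> T y0"
    using e by simp
  with min[OF \<open>y \<in> S\<close>] show ?thesis by simp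
qed

lemma slope_nonneg:
  fixes m k :: real
  assumes "\<And>s. 0 \<le> s \<Longrightarrow> 0 \<le> k + m * s"
  shows "0 \<le> m"
proof (rule ccontr)
  assume m: "\<not> 0 \<le> m"
  then have "0 \<le> (\<bar>k\<bar> + 1) / - m"
    by (intro divide_nonneg_nonneg) auto
  from assms[OF this] m have "0 \<le> k - (\<bar>k\<bar> + 1)"
    by simp
  then show False
    by linarith
qed

text \<open>The point \<open>(0, 0, P)\<close>, with \<open>P\<close> the infimum of the problem, lies on the relative boundary of
  the convex set \<open>C\<close> of attainable (residual, constraint level, objective level) triples. A
  hyperplane supporting \<open>C\<close> there provides multipliers \<open>(lam, mu, nu)\<close>, nonnegative in the last two
  blocks because \<open>C\<close> is closed upwards in them. The Slater point excludes \<open>nu = 0\<close>: the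
  strict inequalities at \<open>y0\<close> force \<open>mu = 0\<close>, and then \<open>y0 \<in> rel_interior Y\<close> makes the supporting
  functional constant on \<open>C\<close>, whereas the hyperplane can be chosen so as not to contain \<open>C\<close>. This
  last point is why the support is taken relative to the affine hull: \<open>T\<close> may fail to map \<open>Y\<close> onto
  a neighbourhood of \<open>c\<close>. Normalizing \<open>nu\<close> to 1 gives multipliers that close the duality gap.\<close>
lemma lagrangian_strong_duality:
  fixes Y :: "'a::euclidean_space set" and F :: "'a \<Rightarrow> real" and G :: "'p::finite \<Rightarrow> 'a \<Rightarrow> real"
    and T :: "'a \<Rightarrow> 'q::euclidean_space"
  assumes Y: "convex Y" and F: "convex_on Y F" and G: "\<And>i. convex_on Y (G i)"
    and T: "linear T"
    and y0: "y0 \<in> rel_interior Y" "T y0 = c" "\<And>i. G i y0 < 0"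
    and lower: "\<And>y. \<lbrakk>y \<in> Y; T y = c; \<And>i. G i y \<le> 0\<rbrakk> \<Longrightarrow> Q \<le> F y"
  obtains lam :: 'q and mu :: "real^'p" where
    "\<And>i. 0 \<le> mu $ i"
    "\<And>y. y \<in> Y \<Longrightarrow> Q \<le> F y + lam \<bullet> (T y - c) + (\<Sum>i\<in>UNIV. mu $ i * G i y)"
proof -
  define feas where "feas = {y \<in> Y. T y = c \<and> (\<forall>i. G i y \<le> 0)}"
  define P where "P = Inf (F ` feas)"
  define C :: "('q \<times> (real^'p) \<times> real) set" where
    "C = {(w, u, r). \<exists>y\<in>Y. w = T y - c \<and> (\<forall>i. G i y \<le> u $ i) \<and> F y \<le> r}"
  have y0Y: "y0 \<in> Y"
    using y0 rel_interior_subset by blast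
  then have y0_feas: "y0 \<in> feas"
    using y0 by (auto simp: feas_def less_imp_le)
  have bdd: "bdd_below (F ` feas)"
    using lower by (auto simp: feas_def bdd_below_def)
  have QP: "Q \<le> P"
    unfolding P_def using y0_feas lower by (intro cINF_greatest) (auto simp: feas_def)
  have P_le: "P \<le> r" if "(0, 0, r) \<in> C" for r
  proof -
    from that obtain y where y: "y \<in> feas" "F y \<le> r"
      by (auto simp: C_def feas_def)
    then show ?thesis
      unfolding P_def using bdd by (meson cINF_lower order_trans)
  qed
  have memC: "(T y - c, (\<chi> i. G i y), F y) \<in> C" if "y \<in> Y" for y
    using that by (auto simp: C_def)
  have "convex C"
  proof (rule convexI)
    fix p q :: "'q \<times> (real^'p) \<times> real" and s t :: real
    assume pq: "p \<in> C" "q \<in> C" and st: "0 \<le> s" "0 \<le> t" "s + t = 1"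
    obtain w u r w' u' r' where pq_eq: "p = (w, u, r)" "q = (w', u', r')"
      by (cases p, cases q) auto
    obtain y where y: "y \<in> Y" "w = T y - c" "\<And>i. G i y \<le> u $ i" "F y \<le> r"
      using pq by (auto simp: C_def pq_eq)
    obtain y' where y': "y' \<in> Y" "w' = T y' - c" "\<And>i. G i y' \<le> u' $ i" "F y' \<le> r'"
      using pq by (auto simp: C_def pq_eq)
    let ?z = "s *\<^sub>R y + t *\<^sub>R y'"
    have jensen: "h ?z \<le> s * a + t * a'" if "convex_on Y h" "h y \<le> a" "h y' \<le> a'" for h a a'
    proof -
      have "h ?z \<le> s * h y + t * h y'"
        using that(1) y y' st by (auto simp: convex_on_def)
      also have "\<dots> \<le> s * a + t * a'"
        using that st by (intro add_mono mult_left_mono)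
      finally show ?thesis .
    qed
    have "s *\<^sub>R w + t *\<^sub>R w' = T ?z - (s + t) *\<^sub>R c"
      using T by (simp add: y y' linear_add linear_scale algebra_simps)
    then have "s *\<^sub>R w + t *\<^sub>R w' = T ?z - c"
      using st by simp
    moreover have "?z \<in> Y"
      using Y y y' st by (simp add: convexD)
    moreover have "F ?z \<le> s * r + t * r'"
      using jensen F y y' by blast
    moreover have "G i ?z \<le> s * u $ i + t * u' $ i" for i
      using jensen G y y' by blast
    ultimately show "s *\<^sub>R p + t *\<^sub>R q \<in> C"
      by (auto simp: C_def pq_eq)
  qed
  (* Otherwise the segment from a point of C above (0, 0, P) could be prolonged below it. *)
  have "(0, 0, P) \<notin> rel_interior C"
  proof
    assume "(0, 0, P) \<in> rel_interior C"
    moreover have above: "(0, 0, F y0) \<in> C"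
      using y0Y y0 by (auto simp: C_def less_imp_le intro!: bexI[of _ y0])
    moreover have "(0, 0, F y0 + 1) \<in> C"
      using y0Y y0 by (auto simp: C_def less_imp_le intro!: bexI[of _ y0])
    ultimately obtain e where e: "e > 1"
        "(1 - e) *\<^sub>R (0, 0, F y0 + 1) + e *\<^sub>R (0, 0, P) \<in> C"
      using convex_rel_interior_iff[OF \<open>convex C\<close>, of "(0, 0, P)"] by blast
    then have "P \<le> (1 - e) * (F y0 + 1) + e * P"
      by (intro P_le) simp
    then have "(e - 1) * (F y0 + 1) \<le> (e - 1) * P"
      by (simp add: algebra_simps)
    then have "F y0 + 1 \<le> P"
      using e by simp
    with P_le[OF above] show False
      by simp
  qed
  moreover have "(0, 0, P) \<in> closure C"
  proof -
    have "\<exists>z\<in>C. dist z (0, 0, P) < e" if "e > 0" for e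
    proof -
      obtain y where y: "y \<in> feas" "F y < P + e"
        using cINF_less_iff[of feas F "P + e"] y0_feas bdd \<open>e > 0\<close> by (auto simp: P_def)
      have "P \<le> F y"
        unfolding P_def using bdd y by (meson cINF_lower)
      have "(0, 0, F y) \<in> C"
        using y by (auto simp: feas_def C_def intro!: bexI[of _ y])
      then show ?thesis
        using y \<open>P \<le> F y\<close> by (intro bexI[of _ "(0, 0, F y)"]) (auto simp: dist_Pair_Pair dist_real_def)
    qed
    then show ?thesis
      by (auto simp: closure_approachable)
  qed
  ultimately obtain a where
    sep: "\<And>z. z \<in> C \<Longrightarrow> a \<bullet> (0, 0, P) \<le> a \<bullet> z" and
    strict: "\<And>z. z \<in> rel_interior C \<Longrightarrow> a \<bullet> (0, 0, P) < a \<bullet> z"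
    using supporting_hyperplane_relative_frontier[OF \<open>convex C\<close>, of "(0, 0, P)"]
      closure_subset by (metis subsetD)
  obtain lam mu nu where a: "a = (lam, mu, nu)"
    by (cases a) auto
  have sepY: "nu * P \<le> lam \<bullet> (T y - c) + mu \<bullet> u + nu * r"
    if "y \<in> Y" "\<And>i. G i y \<le> u $ i" "F y \<le> r" for y u r
  proof -
    have "(T y - c, u, r) \<in> C"
      using that by (auto simp: C_def)
    from sep[OF this] show ?thesis
      by (simp add: a add.assoc)
  qed
  have nu: "0 \<le> nu"
  proof (rule slope_nonneg)
    fix s :: real
    assume "0 \<le> s"
    then show "0 \<le> (lam \<bullet> (T y0 - c) + mu \<bullet> (\<chi> i. G i y0) + nu * F y0 - nu * P) + nu * s"
      using sepY[of y0 "\<chi> i. G i y0" "F y0 + s"] y0Y by (simp add: algebra_simps)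
  qed
  have mu: "0 \<le> mu $ j" for j
  proof (rule slope_nonneg)
    fix s :: real
    assume "0 \<le> s"
    then have "nu * P \<le> lam \<bullet> (T y0 - c) + mu \<bullet> ((\<chi> i. G i y0) + axis j s) + nu * F y0"
      by (intro sepY y0Y) (auto simp: axis_def)
    then show "0 \<le> (lam \<bullet> (T y0 - c) + mu \<bullet> (\<chi> i. G i y0) + nu * F y0 - nu * P) + mu $ j * s"
      by (simp add: inner_add_right inner_axis)
  qed
  have sepF: "nu * P \<le> lam \<bullet> (T y - c) + (\<Sum>i\<in>UNIV. mu $ i * G i y) + nu * F y" if "y \<in> Y" for y
    using sepY[of y "\<chi> i. G i y" "F y"] that by (simp add: inner_vec_def)
  have "nu \<noteq> 0"
  proof
    assume "nu = 0"
    have nonpos: "mu $ i * G i y0 \<le> 0" for i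
      using mu[of i] y0(3)[of i] by (simp add: mult_nonneg_nonpos)
    have "0 \<le> (\<Sum>i\<in>UNIV. mu $ i * G i y0)"
      using sepF[OF y0Y] by (simp add: \<open>nu = 0\<close> y0(2))
    with nonpos have "(\<Sum>i\<in>UNIV. mu $ i * G i y0) = 0"
      by (meson order_antisym sum_nonpos)
    then have "(\<Sum>i\<in>UNIV. - (mu $ i * G i y0)) = 0"
      by (simp add: sum_negf)
    then have "\<forall>i. mu $ i * G i y0 = 0"
      using nonpos by (subst (asm) sum_nonneg_eq_0_iff) auto
    then have "mu = 0"
      using y0(3) by (simp add: vec_eq_iff) (metis less_irrefl)
    (* Now lam alone supports the image of Y, with equality at the relative interior point y0. *)
    have "linear (\<lambda>y. lam \<bullet> T y)"
      using T by (auto intro!: linearI simp: linear_add linear_scale inner_add_right)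
    moreover have "lam \<bullet> T y0 \<le> lam \<bullet> T y" if "y \<in> Y" for y
      using sepF[OF that] by (simp add: \<open>nu = 0\<close> \<open>mu = 0\<close> y0(2) inner_diff_right)
    ultimately have const: "lam \<bullet> T y = lam \<bullet> T y0" if "y \<in> Y" for y
      using linear_min_at_rel_interior[of Y y0 "\<lambda>y. lam \<bullet> T y" y] Y y0(1) that by blast
    have "C \<noteq> {}"
      using memC y0Y by blast
    then obtain z where z: "z \<in> rel_interior C"
      using rel_interior_eq_empty[OF \<open>convex C\<close>] by blast
    then have "z \<in> C"
      using rel_interior_subset by blast
    then have "a \<bullet> z = 0"
      using const by (auto simp: C_def a \<open>nu = 0\<close> \<open>mu = 0\<close> inner_diff_right y0(2))
    with strict[OF z] show False
      by (simp add: a \<open>nu = 0\<close>)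
  qed
  with nu have "nu > 0" by simp
  show ?thesis
  proof (rule that[of "(1 / nu) *\<^sub>R mu" "(1 / nu) *\<^sub>R lam"])
    show "0 \<le> ((1 / nu) *\<^sub>R mu) $ i" for i
      using mu nu by simp
    fix y assume "y \<in> Y"
    from sepF[OF this] have "P \<le> (lam \<bullet> (T y - c) + (\<Sum>i\<in>UNIV. mu $ i * G i y) + nu * F y) / nu"
      using \<open>nu > 0\<close> by (simp add: pos_le_divide_eq mult.commute)
    also have "\<dots> = F y + (1 / nu) *\<^sub>R lam \<bullet> (T y - c)
        + (\<Sum>i\<in>UNIV. ((1 / nu) *\<^sub>R mu) $ i * G i y)"
      using \<open>nu > 0\<close> by (simp add: add_divide_distrib sum_divide_distrib)
    finally show "Q \<le> F y + (1 / nu) *\<^sub>R lam \<bullet> (T y - c)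
        + (\<Sum>i\<in>UNIV. ((1 / nu) *\<^sub>R mu) $ i * G i y)"
      using QP by simp
  qed
qed

section \<open>Partial functions of extended-valued data\<close>

lemma convex_on_partial_ext_convex:
  fixes F :: "'a::real_vector \<times> 'b::real_vector \<Rightarrow> ereal"
  assumes "ext_convex F" "convex S"
    and fin: "\<And>y. y \<in> S \<Longrightarrow> \<bar>F (y, x)\<bar> \<noteq> \<infinity>"
  shows "convex_on S (\<lambda>y. real_of_ereal (F (y, x)))"
proof (rule convex_onI[OF _ \<open>convex S\<close>])
  fix t y z
  assume t: "0 < t" "t < (1::real)" and yz: "y \<in> S" "z \<in> S"
  let ?w = "(1 - t) *\<^sub>R y + t *\<^sub>R z"
  have "?w \<in> S"
    using convexD_alt[OF \<open>convex S\<close> yz, of t] t by simp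
  have "((y, x), real_of_ereal (F (y, x))) \<in> {(z, r). F z \<le> ereal r}"
    "((z, x), real_of_ereal (F (z, x))) \<in> {(z, r). F z \<le> ereal r}"
    using fin yz by (auto simp: ereal_real)
  from convexD_alt[OF assms(1)[unfolded ext_convex_def] this, of t] t
  have "F (?w, (1 - t) *\<^sub>R x + t *\<^sub>R x)
      \<le> ereal ((1 - t) * real_of_ereal (F (y, x)) + t * real_of_ereal (F (z, x)))"
    by simp
  then have "F (?w, x) \<le> ereal ((1 - t) * real_of_ereal (F (y, x)) + t * real_of_ereal (F (z, x)))"
    by (simp flip: scaleR_left.add)
  then show "real_of_ereal (F (?w, x))
      \<le> (1 - t) * real_of_ereal (F (y, x)) + t * real_of_ereal (F (z, x))"
    using fin[OF \<open>?w \<in> S\<close>] by (simp add: real_le_ereal_iff)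
qed

lemma ext_differentiable_on_finite:
  assumes "ext_differentiable_on F S" "z \<in> S"
  shows "\<bar>F z\<bar> \<noteq> \<infinity>"
proof -
  have "\<forall>\<^sub>F w in nhds z. \<bar>F w\<bar> \<noteq> \<infinity>"
    using assms unfolding ext_differentiable_on_def by blast
  then show ?thesis
    by (rule eventually_nhds_x_imp_x)
qed

lemma filterlim_Pair_nhds: "filterlim (\<lambda>y. (y, x)) (nhds (y0, x)) (nhds y0)"
  unfolding nhds_prod by (intro filterlim_Pair filterlim_ident tendsto_const)

lemma ext_differentiable_on_eventually_finite:
  assumes "ext_differentiable_on F S" "(y0, x) \<in> S"
  shows "\<forall>\<^sub>F y in nhds y0. \<bar>F (y, x)\<bar> \<noteq> \<infinity>"
proof -
  have "\<forall>\<^sub>F w in nhds (y0, x). \<bar>F w\<bar> \<noteq> \<infinity>"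
    using assms unfolding ext_differentiable_on_def by blast
  then show ?thesis
    using filterlim_Pair_nhds[of x y0] unfolding filterlim_iff by blast
qed

lemma partial_gderiv:
  fixes F :: "'a::euclidean_space \<times> 'b::real_normed_vector \<Rightarrow> ereal"
  assumes "ext_differentiable_on F S" "(y0, x) \<in> S"
  shows "GDERIV (\<lambda>y. real_of_ereal (F (y, x))) y0 :> grad (\<lambda>y. real_of_ereal (F (y, x))) y0"
proof (rule gderiv_grad)
  have "(\<lambda>w. real_of_ereal (F w)) differentiable (at (y0, x))"
    using assms unfolding ext_differentiable_on_def by blast
  moreover have "(\<lambda>y. (y, x)) differentiable (at y0)"
    by (auto simp: differentiable_def intro!: exI derivative_eq_intros)
  ultimately show "(\<lambda>y. real_of_ereal (F (y, x))) differentiable (at y0)"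
    using differentiable_chain_at[of "\<lambda>y. (y, x)" y0 "\<lambda>w. real_of_ereal (F w)"] by (simp add: o_def)
qed

section \<open>The Lagrangian\<close>

lemma lagrangian_finite:
  assumes "\<bar>f (y, x)\<bar> \<noteq> \<infinity>" "\<And>i. \<bar>g i (y, x)\<bar> \<noteq> \<infinity>"
  shows "lagrangian f g A B b x y lam mu =
    ereal (real_of_ereal (f (y, x)) + lam \<bullet> (B *v x + A *v y - b)
           + (\<Sum>i\<in>UNIV. mu $ i * real_of_ereal (g i (y, x))))"
proof -
  obtain r where r: "f (y, x) = ereal r"
    using assms(1) by (cases "f (y, x)") auto
  have "\<forall>i. \<exists>s. g i (y, x) = ereal s"
    using assms(2) by (metis ereal_real)
  then obtain s where s: "\<And>i. g i (y, x) = ereal (s i)"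
    by metis
  show ?thesis
    by (simp add: lagrangian_def r s)
qed

text \<open>The real part of the extended-valued Lagrangian agrees with a real expression only where all the
  data are finite. Differentiability makes them finite near \<open>y\<close> in the whole space, which
  suffices even when \<open>y\<close> is on the boundary of the feasible region.\<close>
lemma gderiv_lagrangian:
  fixes f :: "(real^'m) \<times> (real^'n) \<Rightarrow> ereal" and g :: "'p::finite \<Rightarrow> (real^'m) \<times> (real^'n) \<Rightarrow> ereal"
    and A :: "real^'m^'q" and B :: "real^'n^'q"
  assumes "ext_differentiable_on f S" "\<And>i. ext_differentiable_on (g i) S" "(y, x) \<in> S"
  shows "GDERIV (\<lambda>y'. real_of_ereal (lagrangian f g A B b x y' lam mu)) y :>
    grad (\<lambda>y. real_of_ereal (f (y, x))) y + adjoint ((*v) A) lam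
    + (\<Sum>i\<in>UNIV. mu $ i *\<^sub>R grad (\<lambda>y. real_of_ereal (g i (y, x))) y)" (is "GDERIV ?l y :> ?D")
proof -
  let ?r = "\<lambda>y. real_of_ereal (f (y, x)) + lam \<bullet> (B *v x + A *v y - b)
           + (\<Sum>i\<in>UNIV. mu $ i * real_of_ereal (g i (y, x)))"
  have "\<forall>\<^sub>F y' in nhds y. \<bar>f (y', x)\<bar> \<noteq> \<infinity> \<and> (\<forall>i. \<bar>g i (y', x)\<bar> \<noteq> \<infinity>)"
    using assms by (intro eventually_conj eventually_all_finite ext_differentiable_on_eventually_finite)
  then have ev: "\<forall>\<^sub>F y' in nhds y. ?r y' = ?l y'"
    by eventually_elim (simp add: lagrangian_finite)
  have "((*v) A has_derivative (*v) A) (at y)"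
    by (rule bounded_linear_imp_has_derivative[OF matrix_vector_mul_bounded_linear])
  then have lin: "((\<lambda>y. lam \<bullet> (B *v x + A *v y - b)) has_derivative (\<lambda>v. lam \<bullet> (A *v v))) (at y)"
    by (auto intro!: derivative_eq_intros)
  have "(?r has_derivative (\<lambda>v. v \<bullet> grad (\<lambda>y. real_of_ereal (f (y, x))) y + lam \<bullet> (A *v v)
      + (\<Sum>i\<in>UNIV. mu $ i * (v \<bullet> grad (\<lambda>y. real_of_ereal (g i (y, x))) y)))) (at y)"
    using partial_gderiv[OF assms(1,3)] partial_gderiv[OF assms(2,3)]
    unfolding gderiv_def
    by (intro has_derivative_add has_derivative_sum has_derivative_mult_right lin)
  moreover have "lam \<bullet> (A *v v) = v \<bullet> adjoint ((*v) A) lam" for v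
    using adjoint_works[OF matrix_vector_mul_linear, of v A lam] by (simp add: inner_commute)
  ultimately have "GDERIV ?r y :> ?D"
    unfolding gderiv_def by (simp add: inner_add_right inner_sum_right)
  then show ?thesis
    unfolding gderiv_def
    by (rule has_derivative_transform_eventually)
      (use ev eventually_nhds_x_imp_x[OF ev] in \<open>auto simp: eventually_at_filter elim: eventually_mono\<close>)
qed

section \<open>Comparison of the two cuts\<close>

theorem proposition4p2:
  fixes X :: "(real^'n) set" and Y :: "(real^'m) set"
    and f :: "(real^'m) \<times> (real^'n) \<Rightarrow> ereal"
    and g :: "'p::finite \<Rightarrow> (real^'m) \<times> (real^'n) \<Rightarrow> ereal"
    and A :: "real^'m^'q" and B :: "real^'n^'q" and b :: "real^'q"
    and xb :: "real^'n" and y0 yh :: "real^'m"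
    and L0 \<epsilon> Lb U L :: real and Lg :: "'p \<Rightarrow> real"
    and lamt :: "real^'n" and lamh :: "real^'q" and muh :: "real^'p"
    and C1 C2 :: "real^'n \<Rightarrow> real"
  assumes X: "convex X" "closed X" "X \<noteq> {}"
    and Y: "convex Y" "closed Y" "Y \<noteq> {}" "compact Y"
    and f: "ext_proper f" "ext_lsc f" "ext_convex f" "ext_differentiable_on f (Y \<times> X)"
    and g: "\<And>i. ext_proper (g i)" "\<And>i. ext_lsc (g i)" "\<And>i. ext_convex (g i)"
      "\<And>i. ext_differentiable_on (g i) (Y \<times> X)" "\<And>i. Y \<times> X \<subseteq> ext_dom (g i)"
    and xb: "xb \<in> X"
    and slater: "y0 \<in> rel_interior Y" "A *v y0 + B *v xb = b" "\<And>i. g i (y0, xb) < 0"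
    and fin: "\<And>y. y \<in> feasible_set Y g A B b xb \<Longrightarrow> \<bar>f (y, xb)\<bar> \<noteq> \<infinity>"
    and L0: "L0 > 0" "cocoercive_on L0 Y (grad (\<lambda>y. real_of_ereal (f (y, xb))))"
    and Lg: "\<And>i. Lg i > 0" "\<And>i. cocoercive_on (Lg i) Y (grad (\<lambda>y. real_of_ereal (g i (y, xb))))"
    and eps: "\<epsilon> \<ge> 0"
    and yh: "eps_opt_min \<epsilon> (\<lambda>y. f (y, xb)) (feasible_set Y g A B b xb) yh"
    and lamt: "eps_opt_max \<epsilon> (copy_dual_fun Y f g A B b xb) UNIV lamt"
    and lamh_muh: "eps_opt_max \<epsilon> (lagrangian_dual_fun Y f g A B b xb)
                     lagrangian_dual_feasible (lamh, muh)"
    and C1: "C1 = cut1 f \<epsilon> xb yh lamt"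
    and C2: "C2 = cut2 Y f g A B b xb yh lamh muh"
    and Lb: "ereal Lb \<le> value_function Y f g A B b xb"
    and U: "U = (real_of_ereal (f (y0, xb)) - Lb + \<epsilon>)
                  / Min (range (\<lambda>i. - real_of_ereal (g i (y0, xb))))"
    and L: "L = L0 + U * Max (range Lg)"
  shows "- 2 * \<epsilon> \<le> C1 xb - C2 xb \<and>
         C1 xb - C2 xb \<le> 2 * \<epsilon> + 2 * diameter Y * sqrt (L * \<epsilon>)"
proof -
  define F where "F y = real_of_ereal (f (y, xb))" for y
  define G where "G i y = real_of_ereal (g i (y, xb))" for i y
  define Lag where "Lag lam mu y = F y + lam \<bullet> (B *v xb + A *v y - b) + (\<Sum>i\<in>UNIV. mu $ i * G i y)"
    for lam :: "real^'q" and mu :: "real^'p" and y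
  let ?feas = "feasible_set Y g A B b xb"
  let ?gF = "grad F" and ?gG = "\<lambda>i. grad (G i)"
  have fin_f: "\<bar>f (y, xb)\<bar> \<noteq> \<infinity>" and fin_g: "\<bar>g i (y, xb)\<bar> \<noteq> \<infinity>" if "y \<in> Y" for i y
    using that xb ext_differentiable_on_finite[OF f(4), of "(y, xb)"]
      ext_differentiable_on_finite[OF g(4), of "(y, xb)" i] by simp_all
  have f_eq: "f (y, xb) = ereal (F y)" and g_eq: "g i (y, xb) = ereal (G i y)" if "y \<in> Y" for i y
    using fin_f[OF that] fin_g[OF that] by (simp_all add: F_def G_def ereal_real)
  have Lag_eq: "lagrangian f g A B b xb y lam mu = ereal (Lag lam mu y)" if "y \<in> Y" for y lam mu
    using lagrangian_finite[of f y xb g A B b lam mu] fin_f[OF that] fin_g[OF that]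
    by (simp add: Lag_def F_def G_def)
  have feas_iff: "y \<in> ?feas \<longleftrightarrow> y \<in> Y \<and> A *v y = b - B *v xb \<and> (\<forall>i. G i y \<le> 0)" for y
    using g_eq[of y] by (auto simp: feasible_set_def algebra_simps simp flip: zero_ereal_def)
  have y0Y: "y0 \<in> Y"
    using slater(1) rel_interior_subset by blast
  have G_y0: "G i y0 < 0" for i
    using slater(3)[of i] g_eq[OF y0Y, of i] by simp
  have y0_feas: "y0 \<in> ?feas"
    using y0Y G_y0 slater(2) by (auto simp: feas_iff less_imp_le algebra_simps)
  have yh_feas: "yh \<in> ?feas"
    using yh by (simp add: eps_opt_min_def)
  then have yhY: "yh \<in> Y"
    by (simp add: feas_iff)

  define Q where "Q = real_of_ereal (value_function Y f g A B b xb)"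
  have Q: "value_function Y f g A B b xb = ereal Q"
  proof -
    have "value_function Y f g A B b xb \<le> ereal (F y0)"
      unfolding value_function_def using y0_feas f_eq[OF y0Y] by (metis INF_lower)
    with Lb show ?thesis
      unfolding Q_def by (cases "value_function Y f g A B b xb") auto
  qed
  have Q_le: "Q \<le> F y" if "y \<in> ?feas" for y
  proof -
    have "ereal Q \<le> f (y, xb)"
      unfolding Q[symmetric] value_function_def using that by (rule INF_lower)
    then show ?thesis
      using f_eq[of y] that by (simp add: feas_iff)
  qed
  have F_yh: "F yh \<le> Q + \<epsilon>"
    using yh f_eq[OF yhY] Q by (simp add: eps_opt_min_def value_function_def)
  have LbQ: "Lb \<le> Q"
    using Lb Q by simp

  have cvx: "convex_on Y F" "convex_on Y (G i)" for i
    unfolding F_def[abs_def] G_def[abs_def]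
    using convex_on_partial_ext_convex[OF f(3) Y(1) fin_f]
      convex_on_partial_ext_convex[OF g(3) Y(1) fin_g] by simp_all
  obtain lam mu where dual:
    "\<And>i. 0 \<le> mu $ i"
    "\<And>y. y \<in> Y \<Longrightarrow> Q \<le> F y + lam \<bullet> (A *v y - (b - B *v xb)) + (\<Sum>i\<in>UNIV. mu $ i * G i y)"
  proof (rule lagrangian_strong_duality[of Y F G "(*v) A" y0 "b - B *v xb" Q])
    show "A *v y0 = b - B *v xb"
      using slater(2) by (simp add: algebra_simps)
    show "Q \<le> F y" if "y \<in> Y" "A *v y = b - B *v xb" "\<And>i. G i y \<le> 0" for y
      using that Q_le by (simp add: feas_iff)
  qed (use Y(1) cvx slater(1) G_y0 in auto)
  (* These multipliers only show that the dual optimal value is at least Q, hence that the given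
     (lamh, muh) has dual value at least Q - \<epsilon>. *)
  have "ereal Q \<le> lagrangian_dual_fun Y f g A B b xb (lam, mu)"
    unfolding lagrangian_dual_fun_def using dual(2)
    by (auto intro!: INF_greatest simp: Lag_eq Lag_def algebra_simps)
  also have "\<dots> \<le> (SUP w\<in>lagrangian_dual_feasible. lagrangian_dual_fun Y f g A B b xb w)"
    using dual(1) by (intro SUP_upper) (simp add: lagrangian_dual_feasible_def)
  finally have "ereal Q - ereal \<epsilon> \<le>
      (SUP w\<in>lagrangian_dual_feasible. lagrangian_dual_fun Y f g A B b xb w) - ereal \<epsilon>"
    by (rule ereal_minus_mono) simp
  also have "\<dots> \<le> lagrangian_dual_fun Y f g A B b xb (lamh, muh)"
    using lamh_muh by (simp add: eps_opt_max_def)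
  finally have theta: "ereal (Q - \<epsilon>) \<le> lagrangian_dual_fun Y f g A B b xb (lamh, muh)"
    by simp
  have Lag_lower: "Q - \<epsilon> \<le> Lag lamh muh y" if "y \<in> Y" for y
  proof -
    have "lagrangian_dual_fun Y f g A B b xb (lamh, muh) \<le> ereal (Lag lamh muh y)"
      unfolding lagrangian_dual_fun_def using that by (auto intro: INF_lower2 simp: Lag_eq)
    then show ?thesis
      using theta order_trans by fastforce
  qed
  have muh: "0 \<le> muh $ i" for i
    using lamh_muh by (simp add: eps_opt_max_def lagrangian_dual_feasible_def)

  define slack where "slack = - (\<Sum>i\<in>UNIV. muh $ i * G i yh)"
  have Lag_yh: "Lag lamh muh yh = F yh - slack"
    using yh_feas by (simp add: feas_iff Lag_def slack_def)
  have slack: "0 \<le> slack"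
    using yh_feas muh by (auto simp: slack_def feas_iff intro!: sum_nonpos mult_nonneg_nonpos)

  (* Multipliers cannot be large: at y0 every unit of multiplier mass costs at least \<gamma>, and the
     Lagrangian there is still at least Lb - \<epsilon>. *)
  define \<gamma> where "\<gamma> = Min (range (\<lambda>i. - G i y0))"
  have \<gamma>: "0 < \<gamma>"
    using G_y0 by (simp add: \<gamma>_def)
  have "(\<Sum>i\<in>UNIV. muh $ i) * \<gamma> \<le> (\<Sum>i\<in>UNIV. muh $ i * - G i y0)"
    unfolding sum_distrib_right using muh by (intro sum_mono mult_left_mono) (auto simp: \<gamma>_def)
  also have "\<dots> = F y0 - Lag lamh muh y0"
    using slater(2) by (simp add: Lag_def sum_negf add.commute)
  also have "\<dots> \<le> F y0 - Lb + \<epsilon>"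
    using Lag_lower[OF y0Y] LbQ by simp
  finally have sum_mu: "(\<Sum>i\<in>UNIV. muh $ i) \<le> U"
    using \<gamma> by (simp add: U \<gamma>_def G_def F_def pos_le_divide_eq)

  define M where "M = L0 + (\<Sum>i\<in>UNIV. muh $ i * Lg i)"
  have M_pos: "0 < M"
    unfolding M_def using L0(1) Lg(1) muh by (intro add_pos_nonneg sum_nonneg) (auto simp: less_imp_le)
  have M_le: "M \<le> L"
  proof -
    have "(\<Sum>i\<in>UNIV. muh $ i * Lg i) \<le> (\<Sum>i\<in>UNIV. muh $ i * Max (range Lg))"
      using muh by (intro sum_mono mult_left_mono) auto
    also have "\<dots> \<le> U * Max (range Lg)"
      unfolding sum_distrib_right[symmetric]
    proof (intro mult_right_mono sum_mu)
      have "Lg undefined \<le> Max (range Lg)"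
        by simp
      then show "0 \<le> Max (range Lg)"
        using Lg(1)[of undefined] by linarith
    qed
    finally show ?thesis
      by (simp add: M_def L)
  qed

  define gL where "gL = ?gF yh + adjoint ((*v) A) lamh + (\<Sum>i\<in>UNIV. muh $ i *\<^sub>R ?gG i yh)"
  have grad_Lag: "grad (\<lambda>y'. real_of_ereal (lagrangian f g A B b xb y' lamh muh)) yh = gL"
    unfolding gL_def F_def[abs_def] G_def[abs_def]
    using f(4) g(4) yhY xb by (intro grad_eqI gderiv_lagrangian[where S = "Y \<times> X"]) auto
  (* The quadratic bounds for f and each g i are summed with weights 1 and muh; this way the
     gradient of the Lagrangian has to be computed at yh only. *)
  have desc_F: "F z \<le> F yh + ?gF yh \<bullet> (z - yh) + L0 / 2 * (norm (z - yh))\<^sup>2" if "z \<in> Y" for z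
    using L0 xb yhY that Y(1)
    by (intro descent_lemma[where S = Y] cocoercive_on_imp_lipschitz[where S = Y])
      (auto simp: F_def[abs_def] intro: partial_gderiv[OF f(4)])
  have desc_G: "G i z \<le> G i yh + ?gG i yh \<bullet> (z - yh) + Lg i / 2 * (norm (z - yh))\<^sup>2" if "z \<in> Y" for z i
    using Lg[of i] xb yhY that Y(1)
    by (intro descent_lemma[where S = Y] cocoercive_on_imp_lipschitz[where S = Y])
      (auto simp: G_def[abs_def] intro: partial_gderiv[OF g(4)])
  have desc: "Lag lamh muh z \<le> Lag lamh muh yh + gL \<bullet> (z - yh) + M / 2 * (norm (z - yh))\<^sup>2"
    if "z \<in> Y" for z
  proof -
    have "(\<Sum>i\<in>UNIV. muh $ i * G i z)
        \<le> (\<Sum>i\<in>UNIV. muh $ i * (G i yh + ?gG i yh \<bullet> (z - yh) + Lg i / 2 * (norm (z - yh))\<^sup>2))"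
      using muh desc_G[OF that] by (intro sum_mono mult_left_mono)
    moreover have "(\<Sum>i\<in>UNIV. muh $ i * (G i yh + ?gG i yh \<bullet> (z - yh) + Lg i / 2 * (norm (z - yh))\<^sup>2))
      = (\<Sum>i\<in>UNIV. muh $ i * G i yh) + (\<Sum>i\<in>UNIV. muh $ i *\<^sub>R ?gG i yh) \<bullet> (z - yh)
        + (\<Sum>i\<in>UNIV. muh $ i * Lg i) / 2 * (norm (z - yh))\<^sup>2"
      by (simp add: inner_sum_left sum_distrib_right sum_divide_distrib sum.distrib distrib_left mult.assoc)
    moreover have "lamh \<bullet> (B *v xb + A *v z - b) =
        lamh \<bullet> (B *v xb + A *v yh - b) + adjoint ((*v) A) lamh \<bullet> (z - yh)"
      using adjoint_works[OF matrix_vector_mul_linear, of "z - yh" A lamh]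
      by (simp add: inner_commute matrix_vector_mult_diff_distrib inner_diff_right inner_diff_left
          inner_add_right inner_add_left)
    ultimately show ?thesis
      using desc_F[OF that] unfolding Lag_def gL_def M_def
      by (simp add: inner_add_left add_divide_distrib distrib_right)
  qed

  define D where "D = diameter Y"
  have D: "0 \<le> D" "norm (y - yh) \<le> D" if "y \<in> Y" for y
    using diameter_bounded_bound[of Y y yh] that yhY Y(4) diameter_ge_0[of Y]
    by (auto simp: D_def dist_norm compact_imp_bounded)
  define gap where "gap = (SUP y\<in>Y. gL \<bullet> (yh - y))"
  have bdd: "bdd_above ((\<lambda>y. gL \<bullet> (yh - y)) ` Y)"
    using Y(4) by (intro bounded_imp_bdd_above compact_imp_bounded compact_continuous_image continuous_intros)
  have gap_nonneg: "0 \<le> gap"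
    using cSUP_upper[OF yhY bdd] by (simp add: gap_def)
  define \<delta> where "\<delta> = 2 * \<epsilon> - slack"
  have decr: "Lag lamh muh yh - \<delta> \<le> Lag lamh muh y" if "y \<in> Y" for y
    using Lag_lower[OF that] F_yh by (simp add: Lag_yh \<delta>_def)
  have \<delta>: "0 \<le> \<delta>"
    using decr[OF yhY] by simp
  have "gL \<bullet> (yh - y) \<le> max (D * sqrt (2 * M * \<delta>)) (2 * \<delta>)" if y: "y \<in> Y" for y
  proof -
    have "t * (gL \<bullet> (yh - y)) - M / 2 * t\<^sup>2 * D\<^sup>2 \<le> \<delta>" if t: "0 \<le> t" "t \<le> 1" for t
    proof -
      have eq: "(1 - t) *\<^sub>R yh + t *\<^sub>R y - yh = t *\<^sub>R (y - yh)"
        by (simp add: algebra_simps)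
      have scale: "gL \<bullet> (t *\<^sub>R (y - yh)) = - (t * (gL \<bullet> (yh - y)))"
        "M / 2 * (norm (t *\<^sub>R (y - yh)))\<^sup>2 = M / 2 * t\<^sup>2 * (norm (y - yh))\<^sup>2"
        by (simp add: inner_diff_right right_diff_distrib, simp add: power_mult_distrib)
      have mem: "(1 - t) *\<^sub>R yh + t *\<^sub>R y \<in> Y"
        using convexD_alt[OF Y(1) yhY y t] .
      have "M / 2 * t\<^sup>2 * (norm (y - yh))\<^sup>2 \<le> M / 2 * t\<^sup>2 * D\<^sup>2"
        using M_pos D(2)[OF y] by (intro mult_left_mono power_mono) auto
      then show ?thesis
        using desc[OF mem] decr[OF mem] scale unfolding eq by linarith
    qed
    from frank_wolfe_gap_bound[OF D(1)[OF y] M_pos \<delta> this] show ?thesis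
      by auto
  qed
  then have gap_le: "gap \<le> max (D * sqrt (2 * M * \<delta>)) (2 * \<delta>)"
    unfolding gap_def using Y(3) by (intro cSUP_least)

  have diff: "C1 xb - C2 xb = - 2 * \<epsilon> + slack + gap"
    by (simp add: C1 C2 cut1_def cut2_def grad_Lag gap_def Lag_eq[OF yhY] Lag_yh F_def[symmetric])
  have "D * sqrt (2 * M * \<delta>) \<le> 2 * D * sqrt (L * \<epsilon>)"
  proof -
    have "2 * M * \<delta> \<le> 2 * L * (2 * \<epsilon>)"
      using M_pos M_le \<delta> slack by (intro mult_mono) (auto simp: \<delta>_def)
    then have "sqrt (2 * M * \<delta>) \<le> sqrt (4 * (L * \<epsilon>))"
      by simp
    also have "\<dots> = 2 * sqrt (L * \<epsilon>)"
      by (simp add: real_sqrt_mult)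
    finally show ?thesis
      using mult_left_mono[OF _ D(1)[OF yhY]] by fastforce
  qed
  moreover have "0 \<le> 2 * D * sqrt (L * \<epsilon>)"
    using D(1)[OF yhY] M_pos M_le eps by simp
  ultimately show ?thesis
    using gap_le gap_nonneg slack \<delta> by (auto simp: diff D_def[symmetric] \<delta>_def)
qed

end
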